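(* There exists $\delta_0>0$ such that for every constant $0<\delta<\delta_0$ the following holds. Let $d=d(n)$ with $1\le d\le n/2$ and let $k=k(n)$ be an integer with $n/\sqrt{d}\le k\le \sqrt{\delta}\,n$. Then w.h.p. $G_n\sim G(n,d/n)$ satisfies $$i_k(G_n)>\big(\delta\,(n/k)^{\delta/2}\big)^k.$$
   Context: $G(n,p)$ is the random graph on $[n]$ with each edge present independently with probability $p$; w.h.p. means with probability tending to 1 as $n\to\infty$. For a graph $G$, $i_k(G)$ is the number of unlabeled (isomorphism classes of) $k$-vertex induced subgraphs of $G$. *)

theory Defs
  imports "HOL-Probability.Probability"
begin

text \<open>Simple graphs on vertex set [n] = {0..<n}, given by their edge set,
  a set of 2-element subsets of {0..<n}.\<close>

definition vpairs :: "nat \<Rightarrow> nat set set" where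
  "vpairs n = {e. e \<subseteq> {..<n} \<and> card e = 2}"

definition Gnp :: "nat \<Rightarrow> real \<Rightarrow> nat set set pmf" where
  "Gnp n p = map_pmf (\<lambda>b. {e \<in> vpairs n. b e})
                 (Pi_pmf (vpairs n) False (\<lambda>_. bernoulli_pmf p))"

definition induced_iso :: "nat set set \<Rightarrow> nat set \<Rightarrow> nat set \<Rightarrow> bool" where
  "induced_iso E S T \<longleftrightarrow> (\<exists>f. bij_betw f S T \<and>
      (\<forall>u\<in>S. \<forall>v\<in>S. {u, v} \<in> E \<longleftrightarrow> {f u, f v} \<in> E))"

definition ksets :: "nat \<Rightarrow> nat \<Rightarrow> nat set set" where
  "ksets n k = {S. S \<subseteq> {..<n} \<and> card S = k}"

definition i_k :: "nat \<Rightarrow> nat \<Rightarrow> nat set set \<Rightarrow> nat" where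
  "i_k n k E = card (ksets n k //
      {(S, T). S \<in> ksets n k \<and> T \<in> ksets n k \<and> induced_iso E S T})"

end

theory Submission
  imports Defs "HOL-Real_Asymp.Real_Asymp"
begin

text \<open>
  Write \<open>p = d/n\<close>, \<open>r = n/k\<close> and \<open>j = \<lfloor>k/2\<rfloor> + 1\<close>. If \<open>r\<close> is below a large constant then the base of the
  target is less than \<open>1\<close>, so a single isomorphism class suffices. Otherwise \<open>p k \<ge> \<surd>d \<ge> r\<close> is large.
  By Chernoff and a union bound over the at most \<open>(e r)^k\<close> sets, w.h.p. every \<open>j\<close>-set spans at least
  \<open>M = p k\<^sup>2 / 64\<close> edges. An injection \<open>g\<close> of a \<open>j\<close>-set \<open>X\<close> to a set disjoint from \<open>X\<close> maps the
  edges inside \<open>X\<close>, if there are at least \<open>M\<close> of them, to edges with probability at most \<open>p^M\<close>, which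
  beats the at most \<open>n^(2 j)\<close> choices of \<open>(X, g)\<close>; so w.h.p. there is no such \<open>g\<close>. An isomorphism
  from \<open>S\<close> to \<open>T\<close> restricts to such a \<open>g\<close> on any \<open>j\<close>-subset of \<open>S - T\<close>, hence isomorphic \<open>k\<close>-sets
  satisfy \<open>|T - S| \<le> k/2\<close>. Each class therefore has at most \<open>(2 e)^k r^(k/2)\<close> members, and there are
  at least \<open>(\<surd>r / (2 e))^k\<close> classes.
\<close>

section \<open>Probabilities in \<open>Gnp\<close>: cylinders, lower tail, transported edges\<close>

lemma finite_vpairs: "finite (vpairs n)"
  unfolding vpairs_def by (rule finite_subset[of _ "Pow {..<n}"]) auto

text \<open>The event is a box in the product space, with side \<open>{True}\<close> on
  \<open>T\<close>, \<open>{False}\<close> on \<open>F\<close> and \<open>UNIV\<close> elsewhere; by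
  independence its probability is the product over the sides, and the full sides contribute
  1.\<close>

lemma prob_Gnp_cylinder:
  assumes T: "T \<subseteq> vpairs n" and F: "F \<subseteq> vpairs n" and TF: "T \<inter> F = {}"
    and p: "0 \<le> p" "p \<le> 1"
  shows "measure_pmf.prob (Gnp n p) {E. T \<subseteq> E \<and> F \<inter> E = {}} = p ^ card T * (1 - p) ^ card F"
proof -
  define B where "B = (\<lambda>e. if e \<in> T then {True} else if e \<in> F then {False} else UNIV)"
  have fin: "finite T" "finite F"
    using T F finite_vpairs finite_subset by blast+
  have pre: "(\<lambda>b. {e \<in> vpairs n. b e}) -` {E. T \<subseteq> E \<and> F \<inter> E = {}} = Pi (vpairs n) B"
    using T F TF by (auto simp: B_def Pi_def split: if_splits)
  have "measure_pmf.prob (Gnp n p) {E. T \<subseteq> E \<and> F \<inter> E = {}}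
      = (\<Prod>e\<in>vpairs n. measure_pmf.prob (bernoulli_pmf p) (B e))"
    unfolding Gnp_def measure_map_pmf pre by (rule measure_Pi_pmf_Pi[OF finite_vpairs])
  also have "\<dots> = (\<Prod>e\<in>T \<union> F. measure_pmf.prob (bernoulli_pmf p) (B e))"
    using T F by (intro prod.mono_neutral_right finite_vpairs) (auto simp: B_def)
  also have "\<dots> = (\<Prod>e\<in>T. measure_pmf.prob (bernoulli_pmf p) (B e))
      * (\<Prod>e\<in>F. measure_pmf.prob (bernoulli_pmf p) (B e))"
    using fin TF by (rule prod.union_disjoint)
  also have "(\<Prod>e\<in>T. measure_pmf.prob (bernoulli_pmf p) (B e)) = (\<Prod>e\<in>T. p)"
    using p by (intro prod.cong) (auto simp: B_def measure_pmf_single)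
  also have "(\<Prod>e\<in>F. measure_pmf.prob (bernoulli_pmf p) (B e)) = (\<Prod>e\<in>F. 1 - p)"
    using p TF by (intro prod.cong) (auto simp: B_def measure_pmf_single)
  finally show ?thesis by simp
qed

text \<open>Splits an event according to which pairs of \<open>P\<close> are edges, so that the
  edges in \<open>P\<close> can be revealed before anything else. In both uses \<open>c Q\<close> is
  a constant times a binomial weight, and the sum closes by the binomial theorem.\<close>

lemma prob_Gnp_le_sum_traces:
  assumes P: "finite P"
    and ev: "\<And>Q. Q \<subseteq> P \<Longrightarrow> measure_pmf.prob (Gnp n p) {E. A E \<and> P \<inter> E = Q} \<le> c Q"
  shows "measure_pmf.prob (Gnp n p) {E. A E} \<le> (\<Sum>Q\<in>Pow P. c Q)"
proof -
  have "measure_pmf.prob (Gnp n p) {E. A E}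
      \<le> measure_pmf.prob (Gnp n p) (\<Union>Q\<in>Pow P. {E. A E \<and> P \<inter> E = Q})"
  proof (rule measure_pmf.finite_measure_mono)
    show "{E. A E} \<subseteq> (\<Union>Q\<in>Pow P. {E. A E \<and> P \<inter> E = Q})"
    proof
      fix E assume "E \<in> {E. A E}"
      then show "E \<in> (\<Union>Q\<in>Pow P. {E. A E \<and> P \<inter> E = Q})"
        by (intro UN_I[of "P \<inter> E"]) simp_all
    qed
  qed simp
  also have "\<dots>
      \<le> (\<Sum>Q\<in>Pow P. measure_pmf.prob (Gnp n p) {E. A E \<and> P \<inter> E = Q})"
    using P by (intro measure_pmf.finite_measure_subadditive_finite) auto
  also have "\<dots> \<le> (\<Sum>Q\<in>Pow P. c Q)"
    using ev by (intro sum_mono) auto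
  finally show ?thesis .
qed

lemma sum_Pow_binomial:
  fixes x y :: "'a :: comm_semiring_1"
  assumes "finite P"
  shows "(\<Sum>Q\<in>Pow P. x ^ card Q * y ^ card (P - Q)) = (x + y) ^ card P"
  using prod_add[OF assms, of "\<lambda>_. x" "\<lambda>_. y"] by simp

text \<open>A Chernoff bound by the exponential moment at parameter -1: a trace \<open>Q\<close>
  with fewer than \<open>M\<close> edges gets the weight \<open>exp (M - card Q)\<close>, which
  exceeds 1. The factor per pair, \<open>p * exp (-1) + (1 - p)\<close>, is at most
  \<open>exp (- p / 2)\<close> because \<open>exp (-1) \<le> 1/2\<close>.\<close>

lemma prob_Gnp_few_edges:
  assumes P: "P \<subseteq> vpairs n" and p: "0 \<le> p" "p \<le> 1"
  shows "measure_pmf.prob (Gnp n p) {E. real (card (P \<inter> E)) < M} \<le> exp (M - p * card P / 2)"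
proof -
  have fin: "finite P" using P finite_vpairs finite_subset by blast
  have "measure_pmf.prob (Gnp n p) {E. real (card (P \<inter> E)) < M}
      \<le> (\<Sum>Q\<in>Pow P. exp M * ((p * exp (-1)) ^ card Q * (1 - p) ^ card (P - Q)))"
  proof (rule prob_Gnp_le_sum_traces[OF fin])
    fix Q assume Q: "Q \<subseteq> P"
    show "measure_pmf.prob (Gnp n p) {E. real (card (P \<inter> E)) < M \<and> P \<inter> E = Q}
        \<le> exp M * ((p * exp (-1)) ^ card Q * (1 - p) ^ card (P - Q))"
    proof (cases "real (card Q) < M")
      case True
      have "measure_pmf.prob (Gnp n p) {E. real (card (P \<inter> E)) < M \<and> P \<inter> E = Q}
          \<le> measure_pmf.prob (Gnp n p) {E. Q \<subseteq> E \<and> (P - Q) \<inter> E = {}}"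
        by (intro measure_pmf.finite_measure_mono) auto
      also have "\<dots> = p ^ card Q * (1 - p) ^ card (P - Q)"
        using Q P p by (intro prob_Gnp_cylinder) auto
      also have "\<dots> \<le> (exp M * exp (-1) ^ card Q) * (p ^ card Q * (1 - p) ^ card (P - Q))"
      proof -
        have "exp M * exp (-1) ^ card Q = exp (M - card Q)"
          using exp_of_nat_mult[of "card Q" "-1 :: real"] by (simp add: exp_diff exp_minus field_simps)
        then have "1 \<le> exp M * exp (-1) ^ card Q" using True by simp
        then have "1 * (p ^ card Q * (1 - p) ^ card (P - Q))
            \<le> (exp M * exp (-1) ^ card Q) * (p ^ card Q * (1 - p) ^ card (P - Q))"
          using p by (intro mult_right_mono) auto
        then show ?thesis by simp
      qed
      finally show ?thesis by (simp add: power_mult_distrib mult_ac)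
    next
      case False
      then have "{E. real (card (P \<inter> E)) < M \<and> P \<inter> E = Q} = {}" by auto
      then show ?thesis using p by (simp only:) simp
    qed
  qed
  also have "\<dots> = exp M * (p * exp (-1) + (1 - p)) ^ card P"
    by (simp add: sum_distrib_left[symmetric] sum_Pow_binomial[OF fin])
  also have "\<dots> \<le> exp M * exp (- p / 2) ^ card P"
  proof -
    have "exp (-1) \<le> (1/2 :: real)"
      using exp_ge_add_one_self[of 1] by (simp add: exp_minus field_simps)
    then have "p * exp (-1) \<le> p * (1/2)" using p by (intro mult_left_mono) auto
    then have "p * exp (-1) + (1 - p) \<le> 1 + (- p / 2)" by simp
    also have "\<dots> \<le> exp (- p / 2)" by (rule exp_ge_add_one_self)
    finally show ?thesis using p by (intro mult_left_mono power_mono) auto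
  qed
  also have "\<dots> = exp (M - p * card P / 2)"
    by (simp add: exp_of_nat_mult[symmetric] exp_add[symmetric] algebra_simps)
  finally show ?thesis .
qed

text \<open>The edges in \<open>P\<close> are revealed first; since \<open>\<phi> ` P\<close> is disjoint from \<open>P\<close>, the images of
  the edges found are then still independent.\<close>

lemma prob_Gnp_edge_preserving:
  assumes P: "P \<subseteq> vpairs n" and \<phi>: "inj_on \<phi> P" "\<phi> ` P \<subseteq> vpairs n" "\<phi> ` P \<inter> P = {}"
    and p: "0 < p" "p \<le> 1"
  shows "measure_pmf.prob (Gnp n p) {E. M \<le> real (card (P \<inter> E)) \<and> \<phi> ` (P \<inter> E) \<subseteq> E} \<le> p powr M"
proof -
  have fin: "finite P" using P finite_vpairs finite_subset by blast
  have "measure_pmf.prob (Gnp n p) {E. M \<le> real (card (P \<inter> E)) \<and> \<phi> ` (P \<inter> E) \<subseteq> E}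
      \<le> (\<Sum>Q\<in>Pow P. p powr M * (p ^ card Q * (1 - p) ^ card (P - Q)))"
  proof (rule prob_Gnp_le_sum_traces[OF fin])
    fix Q assume Q: "Q \<subseteq> P"
    show "measure_pmf.prob (Gnp n p)
          {E. (M \<le> real (card (P \<inter> E)) \<and> \<phi> ` (P \<inter> E) \<subseteq> E) \<and> P \<inter> E = Q}
        \<le> p powr M * (p ^ card Q * (1 - p) ^ card (P - Q))"
    proof (cases "M \<le> real (card Q)")
      case True
      have cd: "card (Q \<union> \<phi> ` Q) = card Q + card Q"
      proof -
        have "card (Q \<union> \<phi> ` Q) = card Q + card (\<phi> ` Q)"
          using Q \<phi> fin finite_subset by (intro card_Un_disjoint) blast+
        then show ?thesis using card_image[OF inj_on_subset[OF \<phi>(1) Q]] by simp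
      qed
      have "measure_pmf.prob (Gnp n p)
          {E. (M \<le> real (card (P \<inter> E)) \<and> \<phi> ` (P \<inter> E) \<subseteq> E) \<and> P \<inter> E = Q}
          \<le> measure_pmf.prob (Gnp n p) {E. Q \<union> \<phi> ` Q \<subseteq> E \<and> (P - Q) \<inter> E = {}}"
        by (intro measure_pmf.finite_measure_mono) auto
      also have "\<dots> = p ^ card (Q \<union> \<phi> ` Q) * (1 - p) ^ card (P - Q)"
      proof (rule prob_Gnp_cylinder)
        show "(Q \<union> \<phi> ` Q) \<inter> (P - Q) = {}" using Q \<phi>(3) by blast
      qed (use Q P p \<phi> in auto)
      \<comment> \<open>The inner \<open>p ^ card Q\<close> belongs to the probability of the trace;
        the outer one is the price of the image edges and is at most
        \<open>p powr M\<close>.\<close>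
      also have "\<dots> = p ^ card Q * (p ^ card Q * (1 - p) ^ card (P - Q))"
        by (simp add: cd power_add)
      also have "\<dots> \<le> p powr M * (p ^ card Q * (1 - p) ^ card (P - Q))"
        using p True by (intro mult_right_mono) (auto simp: powr_realpow[symmetric] intro: powr_mono')
      finally show ?thesis .
    next
      case False
      then have "{E. (M \<le> real (card (P \<inter> E)) \<and> \<phi> ` (P \<inter> E) \<subseteq> E) \<and> P \<inter> E = Q} = {}" by auto
      then show ?thesis using p by (simp only:) simp
    qed
  qed
  also have "\<dots> = p powr M"
    by (simp add: sum_distrib_left[symmetric] sum_Pow_binomial[OF fin])
  finally show ?thesis .
qed

section \<open>Counting subsets, isomorphism classes and nearby \<open>k\<close>-sets\<close>

text \<open>Each counted \<open>Z\<close> gets the weight \<open>r ^ (j - card Z)\<close>, at least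
  1; extending the weighted sum to all subsets of \<open>A\<close> gives
  \<open>r ^ j * (1 + 1 / r) ^ card A\<close>.\<close>

lemma card_small_subsets_le:
  assumes A: "finite A" and r: "1 \<le> r"
  shows "real (card {Z. Z \<subseteq> A \<and> card Z \<le> j}) \<le> r ^ j * exp (card A / r)"
proof -
  have "real (card {Z. Z \<subseteq> A \<and> card Z \<le> j}) = (\<Sum>Z\<in>{Z. Z \<subseteq> A \<and> card Z \<le> j}. 1)" by simp
  also have "\<dots> \<le> (\<Sum>Z\<in>{Z. Z \<subseteq> A \<and> card Z \<le> j}. r ^ j * (1 / r) ^ card Z)"
  proof (rule sum_mono)
    fix Z assume "Z \<in> {Z. Z \<subseteq> A \<and> card Z \<le> j}"
    then have "r ^ card Z \<le> r ^ j" using r by (auto intro: power_increasing)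
    then show "1 \<le> r ^ j * (1 / r) ^ card Z" using r by (simp add: power_divide field_simps)
  qed
  also have "\<dots> \<le> (\<Sum>Z\<in>Pow A. r ^ j * (1 / r) ^ card Z)"
    using A r by (intro sum_mono2) auto
  also have "\<dots> = r ^ j * (1 / r + 1) ^ card A"
    using sum_Pow_binomial[OF A, of "1 / r" 1] by (simp add: sum_distrib_left[symmetric])
  also have "\<dots> \<le> r ^ j * exp (1 / r) ^ card A"
    using r exp_ge_add_one_self[of "1 / r"] by (intro mult_left_mono power_mono) (auto simp: add.commute)
  also have "\<dots> = r ^ j * exp (card A / r)"
    by (simp add: exp_of_nat_mult[symmetric])
  finally show ?thesis .
qed

lemma card_ksets: "card (ksets n k) = n choose k"
  unfolding ksets_def using n_subsets[of "{..<n}" k] by simp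

lemma finite_ksets: "finite (ksets n k)"
  unfolding ksets_def by (rule finite_subset[of _ "Pow {..<n}"]) auto

lemma induced_iso_refl: "induced_iso E S S"
  unfolding induced_iso_def by (rule exI[of _ id]) auto

text \<open>By reflexivity the classes cover all \<open>k\<close>-sets, so an upper bound on the
  class size is a lower bound on the number of classes.\<close>

lemma choose_le_i_k_mult:
  assumes b: "\<And>S. S \<in> ksets n k \<Longrightarrow> real (card {T \<in> ksets n k. induced_iso E S T}) \<le> b"
  shows "real (n choose k) \<le> real (i_k n k E) * b"
proof -
  define R where "R = {(S, T). S \<in> ksets n k \<and> T \<in> ksets n k \<and> induced_iso E S T}"
  have cl: "R `` {S} = {T \<in> ksets n k. induced_iso E S T}" if "S \<in> ksets n k" for S
    using that by (auto simp: R_def)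
  have fin: "finite (ksets n k // R)"
    unfolding quotient_def using finite_ksets by auto
  have "ksets n k \<subseteq> \<Union> (ksets n k // R)"
    using induced_iso_refl by (fastforce simp: quotient_def R_def)
  moreover have "finite (\<Union> (ksets n k // R))"
    by (rule finite_subset[OF _ finite_ksets[of n k]]) (auto simp: quotient_def R_def)
  ultimately have "n choose k \<le> card (\<Union> (ksets n k // R))"
    unfolding card_ksets[symmetric] by (intro card_mono)
  also have "\<dots> \<le> (\<Sum>C\<in>ksets n k // R. card C)"
    by (rule card_Union_le_sum_card)
  finally have "real (n choose k) \<le> (\<Sum>C\<in>ksets n k // R. real (card C))"
    by (metis of_nat_le_iff of_nat_sum)
  also have "\<dots> \<le> (\<Sum>C\<in>ksets n k // R. b)"
    using b by (intro sum_mono) (auto simp: quotient_def cl)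
  also have "\<dots> = real (i_k n k E) * b"
    by (simp add: i_k_def R_def)
  finally show ?thesis .
qed

text \<open>Serves the range of small \<open>n / k\<close>, where the target is below 1.\<close>

lemma i_k_pos:
  assumes "k \<le> n"
  shows "0 < i_k n k E"
proof -
  have "real (n choose k) \<le> real (i_k n k E) * real (card (ksets n k))"
    by (rule choose_le_i_k_mult) (auto intro: card_mono finite_ksets)
  moreover have "0 < real (n choose k)" using assms by simp
  ultimately show ?thesis by (cases "i_k n k E = 0") auto
qed

text \<open>\<open>T\<close> is determined by \<open>T \<inter> S\<close>, with at most
  \<open>2 ^ k\<close> choices, and by the small set \<open>T - S\<close>. Counting the latter with
  \<open>r = n / k\<close> makes the exponent \<open>n / r\<close> equal to
  \<open>k\<close>.\<close>

lemma card_near_ksets_le: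
  assumes S: "S \<in> ksets n k" and k: "0 < k" "k \<le> n"
  shows "real (card {T \<in> ksets n k. card (T - S) \<le> j}) \<le> (2 * exp 1) ^ k * (real n / real k) ^ j"
proof -
  define B where "B = {Z. Z \<subseteq> {..<n} \<and> card Z \<le> j}"
  have fS: "finite S" "card S = k" using S finite_subset by (auto simp: ksets_def)
  have fB: "finite B" unfolding B_def by (rule finite_subset[of _ "Pow {..<n}"]) auto
  have "card {T \<in> ksets n k. card (T - S) \<le> j} \<le> card (Pow S \<times> B)"
  proof (rule card_inj_on_le[where f = "\<lambda>T. (T \<inter> S, T - S)"])
    show "inj_on (\<lambda>T. (T \<inter> S, T - S)) {T \<in> ksets n k. card (T - S) \<le> j}"
      by (rule inj_onI) blast
  qed (use fS fB in \<open>auto simp: ksets_def B_def\<close>)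
  also have "\<dots> = 2 ^ k * card B"
    using fS by (simp add: card_cartesian_product card_Pow)
  finally have "real (card {T \<in> ksets n k. card (T - S) \<le> j}) \<le> real (2 ^ k * card B)"
    using of_nat_le_iff by blast
  also have "\<dots> = 2 ^ k * real (card B)" by simp
  also have "\<dots> \<le> 2 ^ k * ((real n / real k) ^ j * exp (card {..<n} / (real n / real k)))"
    unfolding B_def using k by (intro mult_left_mono card_small_subsets_le) auto
  also have "\<dots> = (2 * exp 1) ^ k * (real n / real k) ^ j"
    using k by (simp add: power_mult_distrib exp_of_nat_mult[symmetric])
  finally show ?thesis .
qed

section \<open>Large overlap of isomorphic sets, given density and rigidity\<close>

abbreviation pairs_of :: "nat set \<Rightarrow> nat set set" where
  "pairs_of X \<equiv> {e. e \<subseteq> X \<and> card e = 2}"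

lemma image_pairs_of:
  assumes "inj_on g X" and "e \<in> pairs_of X"
  shows "g ` e \<in> pairs_of (g ` X)"
  using assms by (auto simp: card_image inj_on_subset)

text \<open>The deterministic core. \<open>S - T\<close> and \<open>T - S\<close> have equal size;
  if it were at least \<open>j\<close>, an isomorphism restricted to a \<open>j\<close>-subset of
  \<open>S - T\<close> would land in \<open>T\<close>, hence off that subset, and would carry its
  many edges to edges, against \<open>rigid\<close>.\<close>

lemma induced_iso_card_diff_less:
  assumes S: "S \<in> ksets n k" and T: "T \<in> ksets n k" and iso: "induced_iso E S T"
    and dense: "\<And>X. X \<in> ksets n j \<Longrightarrow> M \<le> real (card (pairs_of X \<inter> E))"
    and rigid: "\<And>X g. X \<in> ksets n j \<Longrightarrow> g \<in> X \<rightarrow>\<^sub>E {..<n} \<Longrightarrow> inj_on g X \<Longrightarrow> g ` X \<inter> X = {}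
        \<Longrightarrow> M \<le> real (card (pairs_of X \<inter> E)) \<Longrightarrow> \<not> (`) g ` (pairs_of X \<inter> E) \<subseteq> E"
  shows "card (T - S) < j"
proof (rule ccontr)
  assume "\<not> card (T - S) < j"
  moreover have fin: "finite S" "finite T" "card S = k" "card T = k"
    using S T finite_subset by (auto simp: ksets_def)
  then have "card (T - S) = card (S - T)"
    by (simp add: card_Diff_subset_Int Int_commute)
  ultimately obtain X where X: "X \<subseteq> S - T" "card X = j"
    by (metis not_less obtain_subset_with_card_n)
  obtain f where f: "bij_betw f S T"
      "\<And>u v. u \<in> S \<Longrightarrow> v \<in> S \<Longrightarrow> {u, v} \<in> E \<longleftrightarrow> {f u, f v} \<in> E"
    using iso unfolding induced_iso_def by blast
  \<comment> \<open>Restricting makes the map extensional, so it lies in the finite function space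
    of the union bound.\<close>
  define g where "g = restrict f X"
  have gX: "g ` X \<subseteq> T" and inj: "inj_on g X"
    using X f(1) by (auto simp: g_def bij_betw_def inj_on_def)
  have Xn: "X \<in> ksets n j" using X S by (auto simp: ksets_def)
  have "\<not> (`) g ` (pairs_of X \<inter> E) \<subseteq> E"
  proof (rule rigid[OF Xn _ inj _ dense[OF Xn]])
    show "g \<in> X \<rightarrow>\<^sub>E {..<n}" using gX T by (auto simp: ksets_def g_def)
    show "g ` X \<inter> X = {}" using gX X by blast
  qed
  moreover have "g ` e \<in> E" if "e \<in> pairs_of X \<inter> E" for e
  proof -
    have "card e = 2" using that by simp
    then obtain u v where e: "e = {u, v}" unfolding card_2_iff by blast
    then show ?thesis using that f(2)[of u v] X by (auto simp: g_def)
  qed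
  ultimately show False by blast
qed

section \<open>Union bounds for the two bad events\<close>

lemma card_pairs_of: "finite X \<Longrightarrow> card (pairs_of X) = card X choose 2"
  by (simp add: n_subsets)

lemma prob_Gnp_not_dense:
  assumes p: "0 \<le> p" "p \<le> 1"
  shows "measure_pmf.prob (Gnp n p) {E. \<exists>X\<in>ksets n j. real (card (pairs_of X \<inter> E)) < M}
    \<le> real (n choose j) * exp (M - p * real (j choose 2) / 2)"
proof -
  have "measure_pmf.prob (Gnp n p) {E. \<exists>X\<in>ksets n j. real (card (pairs_of X \<inter> E)) < M}
      = measure_pmf.prob (Gnp n p) (\<Union>X\<in>ksets n j. {E. real (card (pairs_of X \<inter> E)) < M})"
    by (rule arg_cong[of _ _ "measure_pmf.prob (Gnp n p)"]) auto
  also have "\<dots> \<le> (\<Sum>X\<in>ksets n j. measure_pmf.prob (Gnp n p) {E. real (card (pairs_of X \<inter> E)) < M})"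
    by (intro measure_pmf.finite_measure_subadditive_finite finite_ksets) auto
  also have "\<dots> \<le> (\<Sum>X\<in>ksets n j. exp (M - p * real (j choose 2) / 2))"
  proof (rule sum_mono)
    fix X assume X: "X \<in> ksets n j"
    then have "card (pairs_of X) = j choose 2"
      using card_pairs_of[of X] finite_subset by (auto simp: ksets_def)
    moreover have "pairs_of X \<subseteq> vpairs n" using X by (auto simp: ksets_def vpairs_def)
    ultimately show "measure_pmf.prob (Gnp n p) {E. real (card (pairs_of X \<inter> E)) < M}
        \<le> exp (M - p * real (j choose 2) / 2)"
      using prob_Gnp_few_edges[OF _ p, of "pairs_of X" n M] by simp
  qed
  also have "\<dots> = real (n choose j) * exp (M - p * real (j choose 2) / 2)"
    by (simp add: card_ksets)
  finally show ?thesis .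
qed

lemma prob_Gnp_not_rigid:
  assumes p: "0 < p" "p \<le> 1"
  shows "measure_pmf.prob (Gnp n p) {E. \<exists>X\<in>ksets n j. \<exists>g\<in>X \<rightarrow>\<^sub>E {..<n}. inj_on g X \<and> g ` X \<inter> X = {} \<and>
      M \<le> real (card (pairs_of X \<inter> E)) \<and> (`) g ` (pairs_of X \<inter> E) \<subseteq> E}
    \<le> real (n choose j) * real n ^ j * p powr M"
proof -
  define I where "I = (SIGMA X:ksets n j. {g \<in> X \<rightarrow>\<^sub>E {..<n}. inj_on g X \<and> g ` X \<inter> X = {}})"
  define A where "A = (\<lambda>(X, g). {E. M \<le> real (card (pairs_of X \<inter> E)) \<and> (`) g ` (pairs_of X \<inter> E) \<subseteq> E})"
  have finX: "finite X" "card X = j" if "X \<in> ksets n j" for X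
    using that finite_subset by (auto simp: ksets_def)
  have finG: "finite {g \<in> X \<rightarrow>\<^sub>E {..<n}. inj_on g X \<and> g ` X \<inter> X = {}}" if "X \<in> ksets n j" for X
    using finX[OF that] by (auto intro: finite_subset[OF _ finite_PiE[of X "\<lambda>_. {..<n}"]])
  have finI: "finite I"
    unfolding I_def using finG by (intro finite_SigmaI finite_ksets)
  have "card I = (\<Sum>X\<in>ksets n j. card {g \<in> X \<rightarrow>\<^sub>E {..<n}. inj_on g X \<and> g ` X \<inter> X = {}})"
    unfolding I_def using finG by (intro card_SigmaI finite_ksets) auto
  also have "\<dots> \<le> (\<Sum>X\<in>ksets n j. n ^ j)"
  proof (rule sum_mono)
    fix X assume X: "X \<in> ksets n j"
    have "card {g \<in> X \<rightarrow>\<^sub>E {..<n}. inj_on g X \<and> g ` X \<inter> X = {}} \<le> card (X \<rightarrow>\<^sub>E {..<n})"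
      using finX[OF X] by (intro card_mono finite_PiE) auto
    then show "card {g \<in> X \<rightarrow>\<^sub>E {..<n}. inj_on g X \<and> g ` X \<inter> X = {}} \<le> n ^ j"
      using finX[OF X] by (simp add: card_PiE)
  qed
  also have "\<dots> = (n choose j) * n ^ j" by (simp add: card_ksets)
  finally have cardI: "real (card I) \<le> real (n choose j) * real n ^ j"
    by (metis of_nat_le_iff of_nat_mult of_nat_power)
  have "measure_pmf.prob (Gnp n p) {E. \<exists>X\<in>ksets n j. \<exists>g\<in>X \<rightarrow>\<^sub>E {..<n}. inj_on g X \<and> g ` X \<inter> X = {} \<and>
      M \<le> real (card (pairs_of X \<inter> E)) \<and> (`) g ` (pairs_of X \<inter> E) \<subseteq> E}
      \<le> measure_pmf.prob (Gnp n p) (\<Union>i\<in>I. A i)" (is "measure_pmf.prob _ ?L \<le> _")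
  proof (rule measure_pmf.finite_measure_mono)
    show "?L \<subseteq> (\<Union>i\<in>I. A i)"
    proof
      fix E assume "E \<in> ?L"
      then obtain X g where "X \<in> ksets n j" "g \<in> X \<rightarrow>\<^sub>E {..<n}" "inj_on g X \<and> g ` X \<inter> X = {} \<and>
          M \<le> real (card (pairs_of X \<inter> E)) \<and> (`) g ` (pairs_of X \<inter> E) \<subseteq> E"
        by (elim CollectE bexE)
      then have "(X, g) \<in> I" "E \<in> A (X, g)" by (simp_all add: I_def A_def)
      then show "E \<in> (\<Union>i\<in>I. A i)" by (rule UN_I)
    qed
  qed simp
  also have "\<dots> \<le> (\<Sum>i\<in>I. measure_pmf.prob (Gnp n p) (A i))"
    by (intro measure_pmf.finite_measure_subadditive_finite finI) auto
  also have "\<dots> \<le> (\<Sum>i\<in>I. p powr M)"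
  proof (rule sum_mono)
    fix i assume i: "i \<in> I"
    obtain X g where Xg: "i = (X, g)" "X \<in> ksets n j" "g \<in> X \<rightarrow>\<^sub>E {..<n}" "inj_on g X" "g ` X \<inter> X = {}"
      using i by (auto simp: I_def)
    have im: "(`) g ` pairs_of X \<subseteq> pairs_of (g ` X)"
      using image_pairs_of[OF Xg(4)] by blast
    have "pairs_of (g ` X) \<inter> pairs_of X = {}"
    proof -
      have False if "e \<subseteq> g ` X" "e \<subseteq> X" "card e = 2" for e
        using that Xg(5) by (metis card.empty le_inf_iff subset_empty zero_neq_numeral)
      then show ?thesis by blast
    qed
    then have "(`) g ` pairs_of X \<inter> pairs_of X = {}" using im by blast
    moreover have "(`) g ` pairs_of X \<subseteq> vpairs n"
    proof -
      have gX: "g ` X \<subseteq> {..<n}" using Xg(3) by auto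
      have "pairs_of (g ` X) \<subseteq> vpairs n"
        unfolding vpairs_def by (rule Collect_mono) (use gX order_trans in blast)
      then show ?thesis using im by (rule order_trans[rotated])
    qed
    moreover have "pairs_of X \<subseteq> vpairs n" using Xg(2) by (auto simp: ksets_def vpairs_def)
    moreover have "inj_on ((`) g) (pairs_of X)"
      using inj_on_image_Pow[OF Xg(4)] by (rule inj_on_subset) auto
    ultimately show "measure_pmf.prob (Gnp n p) (A i) \<le> p powr M"
      unfolding A_def Xg(1) prod.case using p by (intro prob_Gnp_edge_preserving)
  qed
  also have "\<dots> = real (card I) * p powr M" by simp
  also have "\<dots> \<le> real (n choose j) * real n ^ j * p powr M"
    using cardI by (intro mult_right_mono) auto
  finally show ?thesis .
qed

text \<open>Outside both bad events every class is small, and the class count follows. The threshold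
  \<open>M\<close> stays free until \<open>failure_prob_le\<close>.\<close>

lemma prob_Gnp_i_k_ge:
  assumes p: "0 < p" "p \<le> 1" and k: "0 < k" "k \<le> n" and j: "j = k div 2 + 1"
  shows "1 - (real (n choose j) * exp (M - p * real (j choose 2) / 2)
        + real (n choose j) * real n ^ j * p powr M)
    \<le> measure_pmf.prob (Gnp n p)
        {E. real (n choose k) \<le> real (i_k n k E) * ((2 * exp 1) ^ k * (real n / real k) ^ (k div 2))}"
    (is "1 - (?a + ?b) \<le> measure_pmf.prob _ ?G")
proof -
  define A where "A = {E. \<exists>X\<in>ksets n j. real (card (pairs_of X \<inter> E)) < M}"
  define B where "B = {E. \<exists>X\<in>ksets n j. \<exists>g\<in>X \<rightarrow>\<^sub>E {..<n}. inj_on g X \<and> g ` X \<inter> X = {} \<and>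
      M \<le> real (card (pairs_of X \<inter> E)) \<and> (`) g ` (pairs_of X \<inter> E) \<subseteq> E}"
  have "- ?G \<subseteq> A \<union> B"
  proof (rule ccontr)
    assume "\<not> - ?G \<subseteq> A \<union> B"
    then obtain E where E: "E \<notin> ?G" "E \<notin> A" "E \<notin> B" by blast
    have dn: "\<forall>X\<in>ksets n j. \<not> real (card (pairs_of X \<inter> E)) < M"
      using E(2) unfolding A_def mem_Collect_eq bex_simps by simp
    have rg: "\<not> (\<exists>X\<in>ksets n j. \<exists>g\<in>X \<rightarrow>\<^sub>E {..<n}. inj_on g X \<and> g ` X \<inter> X = {} \<and>
        M \<le> real (card (pairs_of X \<inter> E)) \<and> (`) g ` (pairs_of X \<inter> E) \<subseteq> E)"
      using E(3) unfolding B_def mem_Collect_eq .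
    have "real (card {T \<in> ksets n k. induced_iso E S T})
        \<le> (2 * exp 1) ^ k * (real n / real k) ^ (k div 2)" if S: "S \<in> ksets n k" for S
    proof -
      have "card (T - S) < j" if T: "T \<in> ksets n k" "induced_iso E S T" for T
      proof (rule induced_iso_card_diff_less[OF S T])
        show "M \<le> real (card (pairs_of X \<inter> E))" if "X \<in> ksets n j" for X
          using bspec[OF dn that] by simp
        show "\<not> (`) g ` (pairs_of X \<inter> E) \<subseteq> E"
          if "X \<in> ksets n j" "g \<in> X \<rightarrow>\<^sub>E {..<n}" "inj_on g X" "g ` X \<inter> X = {}"
            "M \<le> real (card (pairs_of X \<inter> E))" for X g
          using rg that by blast
      qed
      \<comment> \<open>With \<open>j = k div 2 + 1\<close>, being below \<open>j\<close> means
        being at most \<open>k div 2\<close>.\<close>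
      then have "card {T \<in> ksets n k. induced_iso E S T} \<le> card {T \<in> ksets n k. card (T - S) \<le> k div 2}"
        using finite_ksets[of n k] j by (intro card_mono) (auto simp: less_Suc_eq_le)
      then show ?thesis
        using card_near_ksets_le[OF S k, of "k div 2"] by linarith
    qed
    then have "E \<in> ?G" using choose_le_i_k_mult by blast
    with E(1) show False by blast
  qed
  then have "measure_pmf.prob (Gnp n p) (- ?G) \<le> measure_pmf.prob (Gnp n p) (A \<union> B)"
    by (intro measure_pmf.finite_measure_mono) auto
  also have "\<dots> \<le> measure_pmf.prob (Gnp n p) A + measure_pmf.prob (Gnp n p) B"
    by (intro measure_Un_le) auto
  also have "\<dots> \<le> ?a + ?b"
    unfolding A_def B_def using p by (intro add_mono prob_Gnp_not_dense prob_Gnp_not_rigid) auto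
  finally show ?thesis
    using measure_pmf.prob_compl[of ?G "Gnp n p"] by (simp add: Compl_eq_Diff_UNIV)
qed

section \<open>Estimates for the failure probability\<close>

lemma choose_le_power:
  assumes "0 < k" "k \<le> n" "j \<le> k"
  shows "real (n choose j) \<le> (exp 1 * (real n / real k)) ^ k"
proof -
  define r where "r = real n / real k"
  have r: "1 \<le> r" using assms by (simp add: r_def)
  have "n choose j = card {Z. Z \<subseteq> {..<n} \<and> card Z = j}"
    using n_subsets[of "{..<n}" j] by simp
  also have "\<dots> \<le> card {Z. Z \<subseteq> {..<n} \<and> card Z \<le> j}"
    by (rule card_mono) (auto intro: finite_subset[of _ "Pow {..<n}"])
  finally have "real (n choose j) \<le> real (card {Z. Z \<subseteq> {..<n} \<and> card Z \<le> j})"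
    by simp
  also have "\<dots> \<le> r ^ j * exp (card {..<n} / r)"
    using r by (intro card_small_subsets_le) auto
  also have "\<dots> \<le> r ^ k * exp (card {..<n} / r)"
    using r assms by (intro mult_right_mono power_increasing) auto
  also have "card {..<n} / r = real k * 1"
    using assms by (simp add: r_def)
  also have "r ^ k * exp (real k * 1) = (exp 1 * r) ^ k"
    unfolding exp_of_nat_mult by (simp add: power_mult_distrib)
  finally show ?thesis by (simp add: r_def)
qed

text \<open>As \<open>j choose 2\<close> is at least \<open>k^2 / 16\<close>, half the expected
  number of edges in a \<open>j\<close>-set is at least \<open>2 M\<close>, which leaves a factor
  \<open>exp (- M)\<close>. Since \<open>M = k * (p k / 64)\<close> and \<open>p k \<ge> r\<close>,
  this beats \<open>(e r)^k\<close>. The hypothesis \<open>ln\<close> makes \<open>p powr M\<close>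
  at most \<open>n^(-3k)\<close>, against at most \<open>n^(2k)\<close> choices.\<close>

lemma failure_prob_le:
  fixes p :: real and k :: nat
  defines "M \<equiv> p * real k ^ 2 / 64"
  assumes p: "0 < p" "p \<le> 1" and k: "0 < k" "k \<le> n" "sqrt n \<le> real k" and j: "j = k div 2 + 1"
    and r: "real n / real k \<ge> 10 ^ 20" "real n / real k \<le> p * real k"
    and ln: "3 * ln (real n) \<le> p * real k / 64 * ln (1 / p)"
  shows "real (n choose j) * exp (M - p * real (j choose 2) / 2)
        + real (n choose j) * real n ^ j * p powr M \<le> 2 / sqrt n"
proof -
  define r where "r = real n / real k"
  have n: "1 \<le> real n" using k by linarith
  have jk: "j \<le> k" using j k by linarith
  \<comment> \<open>Needed for \<open>k / 4 \<le> j - 1\<close> below, which fails at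
    \<open>k = 1\<close>, where \<open>j = 1\<close>.\<close>
  have k2: "2 \<le> k"
  proof -
    have "real 4 \<le> 10 ^ 20 * real k" using k by simp
    also have "\<dots> \<le> real n" using r(1) k by (simp add: field_simps)
    finally have "sqrt (real 4) \<le> sqrt (real n)" by (rule real_sqrt_le_mono)
    then show ?thesis using k(3) by simp
  qed
  have "real k ^ 2 / 16 \<le> real (j choose 2)"
  proof -
    have j2: "real (j choose 2) = real j * (real j - 1) / 2"
    proof -
      have "even (j * (j - 1))" using j by (cases "even j") auto
      then have "real (j choose 2) = real (j * (j - 1)) / 2"
        unfolding choose_two using real_of_nat_div by fastforce
      moreover have "real (j - 1) = real j - 1" using j by simp
      ultimately show ?thesis by (simp only: of_nat_mult)
    qed
    have "real k / 2 \<le> real j" "real k / 4 \<le> real j - 1"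
      using j k2 by linarith+
    then have "(real k / 2) * (real k / 4) \<le> real j * (real j - 1)"
      by (intro mult_mono) auto
    then show ?thesis by (simp add: j2 power2_eq_square)
  qed
  then have "p * (real k ^ 2 / 16) \<le> p * real (j choose 2)"
    using p by (intro mult_left_mono) auto
  then have "M - p * real (j choose 2) / 2 \<le> real k * (- (p * real k / 64))"
    by (simp add: M_def power2_eq_square algebra_simps)
  also have "\<dots> \<le> real k * (- (r / 64))"
    using r by (intro mult_left_mono) (auto simp: r_def)
  finally have e1: "exp (M - p * real (j choose 2) / 2) \<le> exp (- (r / 64)) ^ k"
    by (simp add: exp_of_nat_mult[symmetric])
  \<comment> \<open>The quadratic Taylor term of \<open>exp (r / 64)\<close> dominates
    \<open>9 * r\<close>, which bounds \<open>exp 1 * exp 1 * r\<close>, for such large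
    \<open>r\<close>.\<close>
  have base: "exp 1 * r * exp (- (r / 64)) \<le> exp (- 1)"
  proof -
    have "exp 1 * exp 1 * r \<le> 3 * 3 * r"
      using exp_le r by (intro mult_right_mono mult_mono) (auto simp: r_def)
    also have "\<dots> \<le> (r / 64)\<^sup>2 / 2"
      using r unfolding r_def[symmetric] by (simp add: power2_eq_square)
    also have "\<dots> \<le> exp (r / 64)"
      using exp_lower_Taylor_quadratic[of "r / 64"] r unfolding r_def[symmetric] by simp
    finally have "exp 1 * exp 1 * r * exp (- (r / 64)) \<le> exp (r / 64) * exp (- (r / 64))"
      by (intro mult_right_mono) auto
    also have "\<dots> = exp 1 * exp (- 1)" by (simp add: exp_add[symmetric])
    finally have "exp 1 * (exp 1 * r * exp (- (r / 64))) \<le> exp 1 * exp (- 1)"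
      by (simp only: mult.assoc)
    then show ?thesis by (rule mult_left_le_imp_le) simp
  qed
  have "real (n choose j) * exp (M - p * real (j choose 2) / 2) \<le> (exp 1 * r) ^ k * exp (- (r / 64)) ^ k"
    unfolding r_def[symmetric] using choose_le_power[OF k(1,2) jk] e1
    by (intro mult_mono) (auto simp: r_def)
  also have "\<dots> = (exp 1 * r * exp (- (r / 64))) ^ k"
    by (simp add: power_mult_distrib)
  also have "\<dots> \<le> exp (- 1) ^ k"
    using base by (intro power_mono) (auto simp: r_def)
  also have "\<dots> = 1 / exp (real k)"
    using exp_of_nat_mult[of k "-1 :: real"] by (simp add: exp_minus inverse_eq_divide)
  also have "\<dots> \<le> 1 / sqrt n"
  proof -
    have "sqrt n \<le> exp (real k)" using exp_ge_add_one_self[of "real k"] k(3) by linarith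
    then show ?thesis using n by (intro divide_left_mono) auto
  qed
  finally have t1: "real (n choose j) * exp (M - p * real (j choose 2) / 2) \<le> 1 / sqrt n" .
  have "p powr M = (p powr (p * real k / 64)) ^ k"
  proof -
    have "p * real k / 64 * real k = M" by (simp add: M_def power2_eq_square)
    then show ?thesis
      using p powr_powr[of p "p * real k / 64" "real k"] by (simp add: powr_realpow)
  qed
  also have "\<dots> \<le> (1 / real n ^ 3) ^ k"
  proof -
    have "p powr (p * real k / 64) = exp (- (p * real k / 64 * ln (1 / p)))"
      using p by (simp add: powr_def ln_div)
    also have "\<dots> \<le> exp (- (3 * ln (real n)))" using ln by simp
    also have "\<dots> = 1 / real n ^ 3"
      using n exp_of_nat_mult[of 3 "ln (real n)"] by (simp add: exp_minus inverse_eq_divide)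
    finally show ?thesis by (intro power_mono) auto
  qed
  finally have pM: "p powr M \<le> 1 / real n ^ (3 * k)"
    by (simp add: power_mult power_divide)
  have "real (n choose j) \<le> real n ^ j"
    using binomial_le_pow[of j n] jk k by (metis le_trans of_nat_le_iff of_nat_power)
  then have "real (n choose j) * real n ^ j * p powr M \<le> real n ^ j * real n ^ j * (1 / real n ^ (3 * k))"
    using pM by (intro mult_mono) auto
  also have "\<dots> \<le> real n ^ k * real n ^ k * (1 / real n ^ (3 * k))"
    using n jk by (intro mult_right_mono mult_mono power_increasing) auto
  also have "\<dots> = 1 / real n ^ k"
  proof -
    have "3 * k = k + k + k" by simp
    then have "real n ^ (3 * k) = real n ^ k * real n ^ k * real n ^ k"
      by (simp only: power_add)
    then show ?thesis using n by simp
  qed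
  also have "\<dots> \<le> 1 / sqrt n"
  proof -
    have "sqrt n \<le> real n ^ 1" using n by (simp add: real_le_lsqrt power2_eq_square)
    also have "\<dots> \<le> real n ^ k" using n k by (intro power_increasing) auto
    finally show ?thesis using n by (intro divide_left_mono) auto
  qed
  finally show ?thesis using t1 by simp
qed

section \<open>Comparing the target with the class count\<close>

text \<open>The threshold \<open>10 ^ 20\<close> fits \<open>\<delta> < 1 / 10\<close>: its power
  \<open>\<delta> / 2\<close> is \<open>10 powr (10 * \<delta>)\<close>, at most 10, and
  \<open>10 * \<delta> < 1\<close>.\<close>

lemma target_lt_one:
  fixes r \<delta> :: real
  assumes "0 < \<delta>" "\<delta> < 1 / 10" "0 < r" "r < 10 ^ 20"
  shows "\<delta> * r powr (\<delta> / 2) < 1"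
proof -
  have "r powr (\<delta> / 2) \<le> (10 ^ 20) powr (\<delta> / 2)"
    using assms by (intro powr_mono2) auto
  also have "\<dots> = 10 powr (10 * \<delta>)"
    using powr_powr[of "10 :: real" 20 "\<delta> / 2"] powr_realpow[of "10 :: real" 20] by simp
  also have "\<dots> \<le> 10 powr 1" using assms by (intro powr_mono) auto
  finally have "\<delta> * r powr (\<delta> / 2) \<le> \<delta> * 10" using assms by (intro mult_left_mono) auto
  then show ?thesis using assms by linarith
qed

text \<open>Here \<open>\<delta> / 2 \<le> 1 / 4\<close> and \<open>2 * exp 1 \<le> 6 < 10\<close>,
  so the left side stays below \<open>r powr (1 / 4)\<close>.\<close>

lemma target_lt_sqrt:
  fixes r \<delta> :: real
  assumes "0 < \<delta>" "\<delta> < 1 / 10" "10 ^ 20 \<le> r"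
  shows "\<delta> * r powr (\<delta> / 2) * (2 * exp 1) < sqrt r"
proof -
  have r: "1 \<le> r" using assms by simp
  have "\<delta> * r powr (\<delta> / 2) \<le> 1 / 10 * r powr (1 / 4)"
    using assms r by (intro mult_mono powr_mono) auto
  then have "\<delta> * r powr (\<delta> / 2) * (2 * exp 1) \<le> 1 / 10 * r powr (1 / 4) * (2 * 3)"
    using exp_le assms by (intro mult_mono) auto
  also have "\<dots> < 1 * r powr (1 / 4)" using r by simp
  also have "\<dots> \<le> r powr (1 / 2)" using r by (simp add: powr_mono)
  finally show ?thesis using r by (simp add: powr_half_sqrt)
qed

text \<open>With \<open>s = sqrt (n / k)\<close> there are at least \<open>s^(2k)\<close> sets and a
  class has at most \<open>(2 e s)^k\<close> members. So \<open>i\<close> is at least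
  \<open>(s / (2 e))^k\<close>, and it remains to compare bases.\<close>

lemma target_lt_i_k:
  fixes \<delta> :: real
  assumes \<delta>: "0 < \<delta>" "\<delta> < 1 / 10" and k: "0 < k" "k \<le> n" and r: "10 ^ 20 \<le> real n / real k"
    and i: "real (n choose k) \<le> i * ((2 * exp 1) ^ k * (real n / real k) ^ (k div 2))"
  shows "(\<delta> * (real n / real k) powr (\<delta> / 2)) ^ k < i"
proof -
  define s where "s = sqrt (real n / real k)"
  define t where "t = \<delta> * (real n / real k) powr (\<delta> / 2)"
  have s: "1 \<le> s" "s\<^sup>2 = real n / real k"
    using r by (auto simp: s_def)
  have t: "0 < t" "t * (2 * exp 1) < s"
    using target_lt_sqrt[OF \<delta> r] \<delta> k by (auto simp: t_def s_def)
  have i0: "0 < i"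
  proof (rule ccontr)
    assume "\<not> 0 < i"
    then have "i * ((2 * exp 1) ^ k * (real n / real k) ^ (k div 2)) \<le> 0"
      by (intro mult_nonpos_nonneg) auto
    moreover have "0 < real (n choose k)" using k by simp
    ultimately show False using i by linarith
  qed
  have "s ^ k * s ^ k = (real n / real k) ^ k"
    by (simp add: s(2)[symmetric] power_mult_distrib[symmetric] power2_eq_square)
  also have "\<dots> \<le> real (n choose k)"
    using binomial_ge_n_over_k_pow_k[OF k(2)] by simp
  also note i
  also have "i * ((2 * exp 1) ^ k * (real n / real k) ^ (k div 2)) \<le> i * ((2 * exp 1) ^ k * s ^ k)"
  proof -
    \<comment> \<open>For odd \<open>k\<close> the exponent here is \<open>k - 1\<close>;
      \<open>s \<ge> 1\<close> absorbs the rounding.\<close>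
    have "(real n / real k) ^ (k div 2) = s ^ (2 * (k div 2))"
      by (simp add: s(2)[symmetric] power_mult)
    also have "\<dots> \<le> s ^ k" using s by (intro power_increasing) auto
    finally show ?thesis using i0 by (intro mult_left_mono) auto
  qed
  finally have "s ^ k * s ^ k \<le> (i * (2 * exp 1) ^ k) * s ^ k" by (simp add: mult_ac)
  then have "s ^ k \<le> i * (2 * exp 1) ^ k"
    using s by (simp add: mult_le_cancel_right)
  moreover have "(t * (2 * exp 1)) ^ k < s ^ k"
    using t k by (intro power_strict_mono) auto
  ultimately have "(t * (2 * exp 1)) ^ k < i * (2 * exp 1) ^ k" by linarith
  then have "t ^ k * (2 * exp 1) ^ k < i * (2 * exp 1) ^ k"
    unfolding power_mult_distrib[of t] .
  then have "t ^ k < i" by (rule mult_right_less_imp_less) simp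
  then show ?thesis by (simp add: t_def)
qed

section \<open>The bound at a fixed \<open>n\<close> and the limit\<close>

lemma i_k_gt_prob_ge:
  fixes \<delta> d :: real
  assumes \<delta>: "0 < \<delta>" "\<delta> < 1 / 10" and n: "1 \<le> n" "384 * ln (real n) \<le> real n powr (1 / 4)"
    and d: "1 \<le> d" "d \<le> real n / 2"
    and k: "real n / sqrt d \<le> real k" "real k \<le> sqrt \<delta> * real n"
  shows "1 - 2 / sqrt n \<le> measure_pmf.prob (Gnp n (d / real n))
    {E. real (i_k n k E) > (\<delta> * (real n / real k) powr (\<delta> / 2)) ^ k}"
proof -
  have "0 < real n / sqrt d" using n d by simp
  then have k0: "0 < k" using k by (cases "k = 0") auto
  have "sqrt \<delta> * real n \<le> 1 * real n" using \<delta> by (intro mult_right_mono) auto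
  then have kn: "k \<le> n" using k by simp
  show ?thesis
  proof (cases "real n / real k < 10 ^ 20")
    case True
    have "(\<delta> * (real n / real k) powr (\<delta> / 2)) ^ k < 1"
    proof -
      have "(\<delta> * (real n / real k) powr (\<delta> / 2)) ^ k < 1 ^ k"
        using target_lt_one[OF \<delta> _ True] \<delta> k0 kn n by (intro power_strict_mono) auto
      then show ?thesis by simp
    qed
    moreover have "1 \<le> real (i_k n k E)" for E
      using i_k_pos[OF kn, of E] by linarith
    ultimately have "{E. real (i_k n k E) > (\<delta> * (real n / real k) powr (\<delta> / 2)) ^ k} = UNIV"
      using less_le_trans by blast
    then show ?thesis by (simp only:) simp
  next
    case False
    define p where "p = d / real n"
    have p: "0 < p" "p \<le> 1" "p \<le> 1 / 2" using d n by (auto simp: p_def field_simps)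
    have sd: "1 \<le> sqrt d" "sqrt d * sqrt d = d" using d by auto
    \<comment> \<open>The lower bound on \<open>k\<close> is used twice: it gives
      \<open>n / k \<le> sqrt d\<close> here and \<open>sqrt d \<le> p * k\<close> next, which
      together put \<open>p * k\<close> above \<open>n / k\<close>.\<close>
    have rd: "real n / real k \<le> sqrt d"
      using k(1) k0 sd by (simp add: field_simps)
    have "sqrt d = d / real n * (real n / sqrt d)"
      using n sd by (simp add: field_simps)
    also have "\<dots> \<le> p * real k"
      unfolding p_def using d k(1) by (intro mult_left_mono) auto
    finally have pk: "sqrt d \<le> p * real k" .
    have ksq: "sqrt n \<le> real k"
    proof -
      have "sqrt (real n) = real n / sqrt (real n)" using n by (simp add: real_div_sqrt)
      also have "\<dots> \<le> real n / sqrt d"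
        using d sd n by (intro divide_left_mono) auto
      finally show ?thesis using k by linarith
    qed
    have ln: "3 * ln (real n) \<le> p * real k / 64 * ln (1 / p)"
    proof -
      have lnn: "0 \<le> ln (real n)" using n by simp
      have lp: "ln (1 / p) = ln (real n) - ln d" using n d by (simp add: p_def ln_div)
      have lp2: "1 / 2 \<le> ln (1 / p)"
      proof -
        have "1 / 2 \<le> ln (2 :: real)" using ln2_ge_two_thirds by simp
        also have "\<dots> \<le> ln (1 / p)" using p by (subst ln_le_cancel_iff) (auto simp: field_simps)
        finally show ?thesis .
      qed
      \<comment> \<open>Here 192 is 3 times 64. If \<open>d \<le> sqrt n\<close>, then
        \<open>ln (1 / p)\<close> is at least half of \<open>ln n\<close>, and
        \<open>sqrt d \<ge> n / k\<close> is huge. Otherwise \<open>ln (1 / p) \<ge> 1 / 2\<close>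
        from \<open>d \<le> n / 2\<close>, and \<open>sqrt d\<close> exceeds
        \<open>n powr (1 / 4)\<close>.\<close>
      have "192 * ln (real n) \<le> sqrt d * ln (1 / p)"
      proof (cases "d \<le> sqrt (real n)")
        case True
        have "ln d \<le> ln (sqrt (real n))" using True d n by (subst ln_le_cancel_iff) auto
        then have "ln (real n) / 2 \<le> ln (1 / p)" using n by (simp add: lp ln_sqrt)
        moreover have "384 \<le> sqrt d" using False rd by simp
        ultimately have "384 * (ln (real n) / 2) \<le> sqrt d * ln (1 / p)"
          using lnn d by (intro mult_mono) auto
        then show ?thesis by simp
      next
        case False
        have "384 * ln (real n) \<le> real n powr (1 / 4)" by (fact n)
        also have "\<dots> = sqrt (sqrt (real n))"
          using n by (simp add: powr_half_sqrt[symmetric] powr_powr)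
        also have "\<dots> \<le> sqrt d" using False by simp
        finally have "(384 * ln (real n)) * (1 / 2) \<le> sqrt d * ln (1 / p)"
          using lp2 sd by (intro mult_mono) auto
        then show ?thesis by simp
      qed
      also have "\<dots> \<le> p * real k * ln (1 / p)"
        using pk lp2 by (intro mult_right_mono) auto
      finally show ?thesis by simp
    qed
    have "1 - 2 / sqrt n \<le> measure_pmf.prob (Gnp n p)
        {E. real (n choose k) \<le> real (i_k n k E) * ((2 * exp 1) ^ k * (real n / real k) ^ (k div 2))}"
      using failure_prob_le[OF p(1,2) k0 kn ksq refl _ _ ln]
        prob_Gnp_i_k_ge[OF p(1,2) k0 kn refl, of "p * real k ^ 2 / 64"] False rd pk
      by linarith
    also have "\<dots> \<le> measure_pmf.prob (Gnp n p)
        {E. real (i_k n k E) > (\<delta> * (real n / real k) powr (\<delta> / 2)) ^ k}"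
      using target_lt_i_k[OF \<delta> k0 kn] False
      by (intro measure_pmf.finite_measure_mono) auto
    finally show ?thesis by (simp add: p_def)
  qed
qed

theorem theorem3p5:
  shows "\<exists>\<delta>0::real. \<delta>0 > 0 \<and>
    (\<forall>\<delta>::real. 0 < \<delta> \<and> \<delta> < \<delta>0 \<longrightarrow>
      (\<forall>(d :: nat \<Rightarrow> real) (k :: nat \<Rightarrow> nat).
        (\<forall>\<^sub>F n in sequentially.
            1 \<le> d n \<and> d n \<le> real n / 2 \<and>
            real n / sqrt (d n) \<le> real (k n) \<and> real (k n) \<le> sqrt \<delta> * real n)
        \<longrightarrow>
        ((\<lambda>n. measure_pmf.prob (Gnp n (d n / real n))
              {E. real (i_k n (k n) E) >
                  (\<delta> * (real n / real (k n)) powr (\<delta> / 2)) ^ (k n)})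
           \<longlonglongrightarrow> 1)))"
\<comment> \<open>The witness is the range of \<open>\<delta>\<close> in both target
  comparisons.\<close>
proof (intro exI[of _ "1 / 10"] conjI allI impI)
  fix \<delta> :: real and d :: "nat \<Rightarrow> real" and k :: "nat \<Rightarrow> nat"
  assume \<delta>: "0 < \<delta> \<and> \<delta> < 1 / 10"
    and dk: "\<forall>\<^sub>F n in sequentially. 1 \<le> d n \<and> d n \<le> real n / 2 \<and>
      real n / sqrt (d n) \<le> real (k n) \<and> real (k n) \<le> sqrt \<delta> * real n"
  let ?P = "\<lambda>n. measure_pmf.prob (Gnp n (d n / real n))
    {E. real (i_k n (k n) E) > (\<delta> * (real n / real (k n)) powr (\<delta> / 2)) ^ (k n)}"
  have large: "\<forall>\<^sub>F n in sequentially. 384 * ln (real n) \<le> real n powr (1 / 4)"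
    by real_asymp
  show "?P \<longlonglongrightarrow> 1"
  proof (rule tendsto_sandwich)
    show "\<forall>\<^sub>F n in sequentially. 1 - 2 / sqrt (real n) \<le> ?P n"
      using dk large eventually_ge_at_top[of 1]
      by eventually_elim (use \<delta> in \<open>intro i_k_gt_prob_ge; simp\<close>)
    show "(\<lambda>n. 1 - 2 / sqrt (real n)) \<longlonglongrightarrow> 1" by real_asymp
    show "(\<lambda>n. 1) \<longlonglongrightarrow> (1 :: real)" by simp
  qed simp
qed simp

end
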